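(* Let $\beta$ be an arbitrary real non-integer parameter and let $N,n$ be integers with $0\le n\le N$. The first $N+1$ terms of the binomial series $$(1-x)^\beta=\sum_{s=0}^\infty\frac{(-\beta)_s}{s!}x^s$$ coincide with the first $N+1$ terms of the power expansion at $x=0$ of the rational function $$R(x)=\frac{{}_2F_1\!\left({n-N,\,-n-\beta\atop -N};x\right)}{{}_2F_1\!\left({-n,\,n+\beta-N\atop -N};x\right)}=\sum_{s=0}^N\frac{(-\beta)_s}{s!}x^s+O(x^{N+1}).$$
   Context: $(a)_k=a(a+1)\cdots(a+k-1)$. For an integer $0\le n\le N$, ${}_2F_1(-n,c;-N;x)$ denotes the polynomial $\sum_{k=0}^{n}\frac{(-n)_k(c)_k}{(-N)_k\,k!}x^k$, and ${}_2F_1(n-N,c;-N;x)$ the polynomial $\sum_{k=0}^{N-n}\frac{(n-N)_k(c)_k}{(-N)_k\,k!}x^k$. *)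

theory Defs
  imports "HOL-Analysis.Analysis" "HOL-Library.Landau_Symbols"
begin

text \<open>
  The terminating Gauss series \<open>\<^sub>2F\<^sub>1(-m, c; -N; x)\<close>, meant for \<open>m \<le> N\<close>. The explicit cut-off at
  \<open>k = m\<close> is part of the definition: for \<open>k > N\<close> the denominator \<open>(-N)\<^sub>k\<close> vanishes.
\<close>
definition hyp2F1_trunc :: "nat \<Rightarrow> real \<Rightarrow> nat \<Rightarrow> real \<Rightarrow> real" where
  "hyp2F1_trunc m c N x =
     (\<Sum>k=0..m. (pochhammer (- real m) k * pochhammer c k) /
                (pochhammer (- real N) k * fact k) * x ^ k)"

text \<open>
  The upper parameter \<open>n - N\<close> of the numerator appears as \<open>-m\<close> with \<open>m = N - n\<close>, a natural-number
  subtraction that is exact for \<open>n \<le> N\<close>.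
\<close>
definition binom_pade :: "real \<Rightarrow> nat \<Rightarrow> nat \<Rightarrow> real \<Rightarrow> real" where
  "binom_pade \<beta> N n x =
     hyp2F1_trunc (N - n) (- real n - \<beta>) N x /
     hyp2F1_trunc n (real n + \<beta> - real N) N x"

end

theory Submission
  imports Defs
begin

text \<open>
  With \<open>m = N - n\<close> and after multiplication by the binomial coefficient of \<open>N\<close> over \<open>n\<close>, the
  denominator becomes \<open>Q m n \<beta>\<close>, with coefficients \<open>C(m + n - k, m) (\<beta> - m)\<^sub>k / k!\<close>, and the
  numerator becomes \<open>Q n m (-\<beta>)\<close>. Pascal's rule shows that the error
  \<open>D m n \<beta> = Q m n \<beta> (1 - X)\<^sup>\<beta> - Q n m (-\<beta>)\<close> satisfies
  \<open>D (m+1) (n+1) (\<beta>-1) = D m (n+1) (\<beta>-1) + D (m+1) n \<beta>\<close>. By induction on \<open>m + n\<close> all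
  coefficients of \<open>D m n \<beta>\<close> below \<open>X\<^sup>N\<close> vanish; the one of \<open>X\<^sup>N\<close> itself vanishes because, after
  cancelling factorials, its first term is (for \<open>n > 0\<close>) a multiple of a Vandermonde convolution that sums to
  \<open>(0)\<^sub>n / n!\<close>. The cases \<open>m = 0\<close> and \<open>n = 0\<close> are direct.
\<close>

section \<open>The binomial series as a formal power series\<close>

definition fps_one_minus_X_powr :: "'a::field_char_0 \<Rightarrow> 'a fps" where
  "fps_one_minus_X_powr \<beta> = Abs_fps (\<lambda>s. pochhammer (- \<beta>) s / fact s)"

lemma fps_one_minus_X_powr_nth [simp]:
  "fps_nth (fps_one_minus_X_powr \<beta>) s = pochhammer (- \<beta>) s / fact s"
  by (simp add: fps_one_minus_X_powr_def)

text \<open>Chu-Vandermonde: compares coefficients in (1 - X)^(-a) (1 - X)^(-b) = (1 - X)^(-(a +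
  b)).\<close>

lemma pochhammer_fact_convolution:
  fixes a b :: "'a::field_char_0"
  shows "(\<Sum>k\<le>n. (pochhammer a k / fact k) * (pochhammer b (n - k) / fact (n - k)))
           = pochhammer (a + b) n / fact n"
  unfolding pochhammer_binomial_sum sum_divide_distrib
  by (rule sum.cong) (simp_all add: binomial_fact)

text \<open>Up to the common factor \<open>pochhammer c k / fact (Suc k)\<close> this reads c - 1 =
  (c + k) - (k + 1).\<close>

lemma pochhammer_fact_Suc_diff:
  fixes c :: "'a::field_char_0"
  shows "pochhammer (c - 1) (Suc k) / fact (Suc k)
           = pochhammer c (Suc k) / fact (Suc k) - pochhammer c k / fact k"
proof -
  have "pochhammer (c - 1) (Suc k) = (c - 1) * pochhammer c k"
    by (simp add: pochhammer_rec)
  moreover have "pochhammer c (Suc k) = (c + of_nat k) * pochhammer c k"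
    by (simp add: pochhammer_rec')
  moreover have "(1 + of_nat k :: 'a) \<noteq> 0"
    by (metis of_nat_Suc of_nat_neq_0)
  ultimately show ?thesis
    by (simp add: divide_simps) (simp add: algebra_simps)
qed

lemma fps_one_minus_X_mult_nth_Suc:
  fixes F :: "'a::comm_ring_1 fps"
  shows "fps_nth ((1 - fps_X) * F) (Suc k) = fps_nth F (Suc k) - fps_nth F k"
  by (simp add: algebra_simps)

lemma one_minus_X_mult_powr:
  "(1 - fps_X) * fps_one_minus_X_powr (\<beta> - 1) = fps_one_minus_X_powr \<beta>"
proof (rule fps_ext)
  fix k
  show "fps_nth ((1 - fps_X) * fps_one_minus_X_powr (\<beta> - 1)) k
          = fps_nth (fps_one_minus_X_powr \<beta>) k"
  proof (cases k)
    case (Suc j)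
    then show ?thesis
      using pochhammer_fact_Suc_diff[of "1 - \<beta>" j]
      by (simp only: fps_one_minus_X_mult_nth_Suc fps_one_minus_X_powr_nth) simp
  qed simp
qed

section \<open>Rescaled hypergeometric polynomials and their recurrences\<close>

text \<open>Binomial weights make Pascal's rule available. The cut-off keeps the series a polynomial
  when m = 0, where the binomial is constantly 1.\<close>

definition pade_denom :: "nat \<Rightarrow> nat \<Rightarrow> 'a::field_char_0 \<Rightarrow> 'a fps" where
  "pade_denom m n \<beta> = Abs_fps (\<lambda>k. if k \<le> n
     then of_nat ((m + n - k) choose m) * (pochhammer (\<beta> - of_nat m) k / fact k) else 0)"

lemma pade_denom_nth:
  "fps_nth (pade_denom m n \<beta>) k = (if k \<le> n
     then of_nat ((m + n - k) choose m) * (pochhammer (\<beta> - of_nat m) k / fact k) else 0)"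
  by (simp add: pade_denom_def)

text \<open>The rising factorials on the right start at c - 1 and c, those on the left at c.
  Expanding the ones at c - 1 by \<open>pochhammer_fact_Suc_diff\<close> leaves Pascal's
  rule.\<close>

lemma pade_denom_rec_left:
  "(1 - fps_X) * pade_denom (Suc m) n \<beta>
     = pade_denom (Suc m) (Suc n) (\<beta> - 1) - pade_denom m (Suc n) (\<beta> - 1)"
proof (rule fps_ext)
  fix k
  define c where "c = \<beta> - of_nat (Suc m)"
  have c: "\<beta> - 1 - of_nat (Suc m) = c - 1" "\<beta> - 1 - of_nat m = c"
    by (simp_all add: c_def)
  show "fps_nth ((1 - fps_X) * pade_denom (Suc m) n \<beta>) k =
        fps_nth (pade_denom (Suc m) (Suc n) (\<beta> - 1) - pade_denom m (Suc n) (\<beta> - 1)) k"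
  proof (cases k)
    case 0
    then show ?thesis by (simp add: pade_denom_nth)
  next
    case (Suc j)
    define p q where "p = pochhammer c j / fact j"
      and "q = pochhammer c (Suc j) / fact (Suc j)"
    have pq: "pochhammer (c - 1) (Suc j) / fact (Suc j) = q - p"
      unfolding p_def q_def by (rule pochhammer_fact_Suc_diff)
    \<comment> \<open>At j = n the cut-off removes the leading term on the left; both sides equal
      -p.\<close>
    consider "j < n" | "j = n" | "j > n" by linarith
    then show ?thesis
    proof cases
      case 1
      define r where "r = m + n - j"
      have r: "Suc m + n - Suc j = r" "Suc m + n - j = Suc r"
        "Suc m + Suc n - Suc j = Suc r" "m + Suc n - Suc j = r"
        using 1 by (auto simp: r_def)
      show ?thesis
        unfolding Suc fps_one_minus_X_mult_nth_Suc fps_sub_nth pade_denom_nth c r pq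
          c_def[symmetric] p_def[symmetric] q_def[symmetric]
        using 1 by (simp add: algebra_simps)
    next
      case 2
      show ?thesis
        unfolding Suc fps_one_minus_X_mult_nth_Suc fps_sub_nth pade_denom_nth c pq
          c_def[symmetric] p_def[symmetric] q_def[symmetric]
        using 2 by simp
    next
      case 3
      then show ?thesis
        unfolding Suc fps_one_minus_X_mult_nth_Suc fps_sub_nth pade_denom_nth by simp
    qed
  qed
qed

text \<open>All three rising factorials start at \<beta> - n, so this is Pascal's rule term by
  term.\<close>

lemma pade_denom_rec_right:
  "pade_denom n (Suc m) \<beta>
     = pade_denom (Suc n) (Suc m) (\<beta> + 1) - pade_denom (Suc n) m (\<beta> + 1)"
proof (rule fps_ext)
  fix k
  have c: "\<beta> + 1 - of_nat (Suc n) = \<beta> - of_nat n"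
    by simp
  consider "k \<le> m" | "k = Suc m" | "k > Suc m" by linarith
  then show "fps_nth (pade_denom n (Suc m) \<beta>) k =
    fps_nth (pade_denom (Suc n) (Suc m) (\<beta> + 1) - pade_denom (Suc n) m (\<beta> + 1)) k"
  proof cases
    case 1
    define r where "r = n + Suc m - k"
    have r: "n + Suc m - k = r" "Suc n + m - k = r" "Suc n + Suc m - k = Suc r"
      using 1 by (auto simp: r_def)
    show ?thesis
      unfolding fps_sub_nth pade_denom_nth c r using 1 by (simp add: algebra_simps add_divide_distrib)
  qed (simp_all add: pade_denom_nth)
qed

section \<open>The error series and its vanishing coefficients\<close>

definition pade_error :: "nat \<Rightarrow> nat \<Rightarrow> 'a::field_char_0 \<Rightarrow> 'a fps" where
  "pade_error m n \<beta>
     = pade_denom m n \<beta> * fps_one_minus_X_powr \<beta> - pade_denom n m (- \<beta>)"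

text \<open>(1 - X)^(\<beta>+1) passes a factor 1 - X to its denominator, so the denominators
  satisfy \<open>pade_denom_rec_left\<close>; the numerators, with indices swapped and parameter
  negated, satisfy \<open>pade_denom_rec_right\<close>.\<close>

lemma pade_error_rec:
  "pade_error (Suc m) (Suc n) \<beta>
     = pade_error m (Suc n) \<beta> + pade_error (Suc m) n (\<beta> + 1)"
proof -
  have "pade_denom (Suc m) n (\<beta> + 1) * fps_one_minus_X_powr (\<beta> + 1)
      = ((1 - fps_X) * pade_denom (Suc m) n (\<beta> + 1)) * fps_one_minus_X_powr \<beta>"
    using one_minus_X_mult_powr[of "\<beta> + 1"] by (simp add: mult_ac)
  also have "\<dots> = (pade_denom (Suc m) (Suc n) \<beta> - pade_denom m (Suc n) \<beta>)
      * fps_one_minus_X_powr \<beta>"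
    using pade_denom_rec_left[of m n "\<beta> + 1"] by simp
  finally show ?thesis
    using pade_denom_rec_right[of n m "- 1 - \<beta>"]
    by (simp add: pade_error_def algebra_simps)
qed

lemma pade_error_nth_top: "fps_nth (pade_error m n \<beta>) (m + n) = 0"
proof -
  define c where "c = \<beta> - of_nat m"
  have "fps_nth (pade_denom m n \<beta> * fps_one_minus_X_powr \<beta>) (m + n)
      = (\<Sum>k=0..m+n. fps_nth (pade_denom m n \<beta>) k
           * (pochhammer (- \<beta>) (m + n - k) / fact (m + n - k)))"
    by (simp add: fps_mult_nth)
  also have "\<dots> = (\<Sum>k\<le>n. fps_nth (pade_denom m n \<beta>) k
           * (pochhammer (- \<beta>) (m + n - k) / fact (m + n - k)))"
    by (rule sum.mono_neutral_right) (auto simp: pade_denom_nth)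
  also have "\<dots> = (\<Sum>k\<le>n. pochhammer (- \<beta>) m / fact m *
      ((pochhammer c k / fact k) * (pochhammer (- c) (n - k) / fact (n - k))))"
  proof (rule sum.cong)
    fix k assume "k \<in> {..n}"
    then have k: "k \<le> n" by simp
    then have *: "m + n - k = m + (n - k)" by simp
    \<comment> \<open>Splitting after m factors leaves a rising factorial starting at m - \<beta> =
      -c, so the two parameters of the convolution cancel.\<close>
    have "pochhammer (- \<beta>) (m + n - k) = pochhammer (- \<beta>) m * pochhammer (- c) (n - k)"
      unfolding * by (simp add: pochhammer_product' c_def)
    moreover have "of_nat ((m + n - k) choose m) / fact (m + n - k)
        = (1 / (fact m * fact (n - k)) :: 'a)"
      unfolding * by (subst binomial_fact) auto
    ultimately show "fps_nth (pade_denom m n \<beta>) k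
           * (pochhammer (- \<beta>) (m + n - k) / fact (m + n - k)) =
        pochhammer (- \<beta>) m / fact m *
      ((pochhammer c k / fact k) * (pochhammer (- c) (n - k) / fact (n - k)))"
      using k by (simp add: pade_denom_nth c_def[symmetric] field_simps)
  qed simp
  also have "\<dots> = pochhammer (- \<beta>) m / fact m * (pochhammer 0 n / fact n)"
    by (simp only: sum_distrib_left[symmetric] pochhammer_fact_convolution) simp
  \<comment> \<open>For n > 0 the product and the numerator both have coefficient 0; for n = 0 both
    have (-\<beta>)_m / m!.\<close>
  finally show ?thesis
    by (simp add: pade_error_def pade_denom_nth pochhammer_0_left)
qed

lemma pade_error_nth_eq_0: "s \<le> m + n \<Longrightarrow> fps_nth (pade_error m n \<beta>) s = 0"
proof (induction "m + n" arbitrary: m n \<beta>)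
  case 0
  then show ?case using pade_error_nth_top[of m n \<beta>] by simp
next
  case (Suc N)
  \<comment> \<open>The recurrence lowers m + n by one, so the induction hypothesis only reaches s <
    m + n.\<close>
  consider "s = m + n" | "m = 0" | "n = 0"
    | m' n' where "s < m + n" "m = Suc m'" "n = Suc n'"
    using Suc.prems by (metis le_neq_implies_less not0_implies_Suc)
  then show ?case
  proof cases
    case 1
    then show ?thesis by (simp add: pade_error_nth_top)
  next
    case 2
    \<comment> \<open>Here the denominator is (1 - X)^(-\<beta>) truncated after X^n, and the
      numerator is 1.\<close>
    with Suc.prems have "s \<le> n" by simp
    then have "fps_nth (pade_denom m n \<beta> * fps_one_minus_X_powr \<beta>) s
      = (\<Sum>k\<le>s. (pochhammer \<beta> k / fact k) * (pochhammer (- \<beta>) (s - k) / fact (s - k)))"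
      unfolding fps_mult_nth
      by (intro sum.cong) (auto simp: pade_denom_nth 2)
    also have "\<dots> = pochhammer 0 s / fact s"
      by (simp only: pochhammer_fact_convolution) simp
    finally show ?thesis
      using 2 by (simp add: pade_error_def pade_denom_nth pochhammer_0_left)
  next
    case 3
    \<comment> \<open>Now the numerator is the truncation of (1 - X)^\<beta> after X^m.\<close>
    have "pade_denom m n \<beta> = 1"
      by (rule fps_ext) (auto simp: pade_denom_nth 3)
    then show ?thesis
      using 3 Suc.prems by (simp add: pade_error_def pade_denom_nth)
  next
    case 4
    then show ?thesis
      using Suc.hyps(1)[of m' n \<beta>] Suc.hyps(1)[of m n' "\<beta> + 1"] Suc.hyps(2)
      by (simp add: pade_error_rec)
  qed
qed

section \<open>From formal series to functions near 0\<close>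

lemma pochhammer_minus_of_nat:
  assumes "k \<le> n"
  shows "pochhammer (- of_nat n :: 'a::field_char_0) k = (- 1) ^ k * fact n / fact (n - k)"
proof -
  have "(- 1) ^ k * pochhammer (- of_nat n :: 'a) k / fact k = fact n / (fact k * fact (n - k))"
    using gbinomial_pochhammer[of "of_nat n :: 'a" k] binomial_fact[OF assms, where ?'a = 'a]
    by (simp add: binomial_gbinomial)
  then show ?thesis
    by (cases "even k") (simp_all add: field_simps eq_neg_iff_add_eq_0 neg_eq_iff_add_eq_0)
qed

lemma hyp2F1_trunc_has_fps_expansion:
  "hyp2F1_trunc n (\<gamma> - real m) (m + n) has_fps_expansion
     fps_const (1 / real ((m + n) choose m)) * pade_denom m n \<gamma>"
proof -
  define a where "a k = (pochhammer (- real n) k * pochhammer (\<gamma> - real m) k) /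
                (pochhammer (- real (m + n)) k * fact k)" for k
  have "(\<lambda>x. \<Sum>k=0..n. a k * x ^ k) has_fps_expansion (\<Sum>k=0..n. fps_const (a k) * fps_X ^ k)"
    by (intro fps_expansion_intros)
  also have "(\<lambda>x. \<Sum>k=0..n. a k * x ^ k) = hyp2F1_trunc n (\<gamma> - real m) (m + n)"
    by (simp add: fun_eq_iff hyp2F1_trunc_def a_def)
  also have "(\<Sum>k=0..n. fps_const (a k) * fps_X ^ k)
      = fps_const (1 / real ((m + n) choose m)) * pade_denom m n \<gamma>"
  proof (rule fps_ext)
    fix k
    have "fps_nth (\<Sum>k=0..n. fps_const (a k) * fps_X ^ k) k = (if k \<le> n then a k else 0)"
      by (simp add: fps_sum_nth if_distrib cong: if_cong)
    also have "\<dots> = fps_nth (fps_const (1 / real ((m + n) choose m)) * pade_denom m n \<gamma>) k"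
    proof (cases "k \<le> n")
      case True
      then have *: "m + n - k - m = n - k" "m \<le> m + n - k" "k \<le> m + n" by auto
      \<comment> \<open>The signs cancel, and both sides are n! (m+n-k)! / ((n-k)! (m+n)!).\<close>
      have "pochhammer (- real n) k / pochhammer (- real (m + n)) k
          = real ((m + n - k) choose m) / real ((m + n) choose m)"
        using True * by (simp only: pochhammer_minus_of_nat binomial_fact) (simp add: binomial_fact)
      then have "a k = real ((m + n - k) choose m) / real ((m + n) choose m)
            * (pochhammer (\<gamma> - real m) k / fact k)"
        unfolding a_def by (metis times_divide_times_eq)
      then show ?thesis using True by (simp add: pade_denom_nth)
    qed (simp add: pade_denom_nth)
    finally show "fps_nth (\<Sum>k=0..n. fps_const (a k) * fps_X ^ k) k =
        fps_nth (fps_const (1 / real ((m + n) choose m)) * pade_denom m n \<gamma>) k" .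
  qed
  finally show ?thesis .
qed

text \<open>Shifting the series by n shows that f(x) / x^n has a finite limit at 0.\<close>

lemma has_fps_expansion_imp_bigo_power:
  fixes F :: "'a::{banach, real_normed_field} fps"
  assumes "f has_fps_expansion F" and "\<And>s. s < n \<Longrightarrow> fps_nth F s = 0"
  shows "f \<in> O[at 0](\<lambda>x. x ^ n)"
\<comment> \<open>The zero series has \<open>subdegree\<close> 0 by convention, so it needs its own
  case.\<close>
proof (cases "F = 0")
  case True
  then have "eventually (\<lambda>x. f x = 0) (nhds 0)"
    using assms(1) by (auto simp: has_fps_expansion_def elim: eventually_mono)
  then have "eventually (\<lambda>x. f x = 0) (at 0)"
    by (simp add: eventually_nhds_conv_at)
  then show ?thesis
    by (intro bigoI[of _ 0]) (auto elim: eventually_mono)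
next
  case False
  then have "n \<le> subdegree F" using assms(2) by (intro subdegree_geI) auto
  then have "(\<lambda>x. if x = 0 then fps_nth F n else f x / x ^ n) has_fps_expansion fps_shift n F"
    using assms(1) by (intro has_fps_expansion_shift) auto
  then have "isCont (\<lambda>x. if x = 0 then fps_nth F n else f x / x ^ n) 0"
    by (rule has_fps_expansion_imp_continuous)
  then have "((\<lambda>x. if x = 0 then fps_nth F n else f x / x ^ n) \<longlongrightarrow> fps_nth F n) (at 0)"
    by (simp add: isCont_def)
  then have "((\<lambda>x. f x / x ^ n) \<longlongrightarrow> fps_nth F n) (at 0)"
    by (rule Lim_transform_eventually) (auto simp: eventually_at_filter)
  then show ?thesis
    by (rule bigoI_tendsto)
      (rule eventually_mono[OF eventually_neq_at_within[of 0]], simp)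
qed

theorem propositionB3:
  fixes \<beta> :: real and N n :: nat
  assumes "\<beta> \<notin> \<int>" and "n \<le> N"
  shows "(\<forall>x::real. \<bar>x\<bar> < 1 \<longrightarrow>
            (\<lambda>s. pochhammer (- \<beta>) s / fact s * x ^ s) sums ((1 - x) powr \<beta>)) \<and>
         (\<exists>F :: real fps. binom_pade \<beta> N n has_fps_expansion F \<and>
            (\<forall>s\<le>N. fps_nth F s = pochhammer (- \<beta>) s / fact s)) \<and>
         (\<lambda>x. binom_pade \<beta> N n x - (\<Sum>s=0..N. pochhammer (- \<beta>) s / fact s * x ^ s))
            \<in> O[at 0](\<lambda>x. x ^ (N + 1))"
proof (intro conjI allI impI)
  fix x :: real assume "\<bar>x\<bar> < 1"
  then have "(\<lambda>s. (\<beta> gchoose s) * (- x) ^ s) sums (1 + - x) powr \<beta>"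
    by (intro gen_binomial_real) simp
  also have "(\<lambda>s. (\<beta> gchoose s) * (- x) ^ s) = (\<lambda>s. pochhammer (- \<beta>) s / fact s * x ^ s)"
    by (subst power_minus) (simp add: fun_eq_iff gbinomial_pochhammer)
  finally show "(\<lambda>s. pochhammer (- \<beta>) s / fact s * x ^ s) sums (1 - x) powr \<beta>"
    by simp
next
  define m where "m = N - n"
  have N: "N = m + n" using assms(2) by (simp add: m_def)
  define C where "C = fps_const (1 / real ((m + n) choose m))"
  define P Q where "P = C * pade_denom n m (- \<beta>)" and "Q = C * pade_denom m n \<beta>"
  define F where "F = P / Q"
  \<comment> \<open>The constant term is 1, so Q is a unit and P / Q a genuine quotient.\<close>
  have Q0: "fps_nth Q 0 \<noteq> 0"
    by (simp add: Q_def C_def pade_denom_nth)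
  \<comment> \<open>The same expansion with m and n swapped; symmetry of the binomial gives both
    polynomials the same scale C.\<close>
  have num: "hyp2F1_trunc m (- real n - \<beta>) N has_fps_expansion P"
    using hyp2F1_trunc_has_fps_expansion[of m "- \<beta>" n] binomial_symmetric[of m "m + n"]
    by (simp add: P_def C_def N add.commute minus_diff_commute)
  have den: "hyp2F1_trunc n (real n + \<beta> - real N) N has_fps_expansion Q"
    using hyp2F1_trunc_has_fps_expansion[of n \<beta> m] by (simp add: Q_def C_def N)
  have F: "binom_pade \<beta> N n has_fps_expansion F"
    using has_fps_expansion_divide'[OF num den Q0]
    by (simp add: F_def m_def binom_pade_def[abs_def])
  have "F * Q = P"
    unfolding F_def using Q0 by (simp add: fps_divide_unit mult.assoc inverse_mult_eq_1)
  then have eq: "(fps_one_minus_X_powr \<beta> - F) * Q = C * pade_error m n \<beta>"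
    by (auto simp: P_def Q_def pade_error_def algebra_simps)
  have coeff: "fps_nth F s = pochhammer (- \<beta>) s / fact s" if "s \<le> N" for s
  \<comment> \<open>Multiplication by the unit Q preserves the order of a nonzero series, so the
    order of the error passes to (1 - X)^\<beta> - F.\<close>
  proof (cases "fps_one_minus_X_powr \<beta> - F = 0")
    case True
    then show ?thesis by (metis fps_one_minus_X_powr_nth eq_iff_diff_eq_0)
  next
    case False
    moreover have "Q \<noteq> 0" "subdegree Q = 0" using Q0 by auto
    ultimately have "subdegree (fps_one_minus_X_powr \<beta> - F)
        = subdegree ((fps_one_minus_X_powr \<beta> - F) * Q)"
      by simp
    moreover have "Suc N \<le> subdegree ((fps_one_minus_X_powr \<beta> - F) * Q)"
    proof (rule subdegree_geI)
      show "(fps_one_minus_X_powr \<beta> - F) * Q \<noteq> 0" using False \<open>Q \<noteq> 0\<close> by simp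
      show "fps_nth ((fps_one_minus_X_powr \<beta> - F) * Q) i = 0" if "i < Suc N" for i
        using that by (simp add: eq C_def N pade_error_nth_eq_0)
    qed
    ultimately have "fps_nth (fps_one_minus_X_powr \<beta> - F) s = 0"
      using that by (intro nth_less_subdegree_zero) simp
    then show ?thesis by simp
  qed
  with F show "\<exists>F :: real fps. binom_pade \<beta> N n has_fps_expansion F \<and>
      (\<forall>s\<le>N. fps_nth F s = pochhammer (- \<beta>) s / fact s)"
    by blast
  define S where "S = (\<Sum>s=0..N. fps_const (pochhammer (- \<beta>) s / fact s) * fps_X ^ s)"
  have "(\<lambda>x. binom_pade \<beta> N n x - (\<Sum>s=0..N. pochhammer (- \<beta>) s / fact s * x ^ s))
      has_fps_expansion F - S"
    unfolding S_def by (intro fps_expansion_intros F)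
  then show "(\<lambda>x. binom_pade \<beta> N n x - (\<Sum>s=0..N. pochhammer (- \<beta>) s / fact s * x ^ s))
      \<in> O[at 0](\<lambda>x. x ^ (N + 1))"
  proof (rule has_fps_expansion_imp_bigo_power)
    fix s assume "s < N + 1"
    then show "fps_nth (F - S) s = 0"
      by (simp add: coeff S_def fps_sum_nth if_distrib cong: if_cong)
  qed
qed

end
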